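(* Let $(\mathbf{X},d)$ be a Polish space and let $\mathbb{L}:C_b(\mathbf{X})\to\mathbb{R}$ be a maximal Varadhan functional which is $\sigma$-continuous. Then there is $L_0\in\mathbb{R}$ such that, with the rate function $\mathbb{I}:\mathbf{X}\to[0,\infty]$ given by $$\mathbb{I}(x)=\mathbb{L}(0)+\sup_{F\in C_b(\mathbf{X})}\{F(x)-\mathbb{L}(F)\},\qquad x\in\mathbf{X},$$ the variational representation $$\mathbb{L}(F)=L_0+\sup_{x\in\mathbf{X}}\{F(x)-\mathbb{I}(x)\}$$ holds for all $F\in C_b(\mathbf{X})$. Furthermore, $\mathbb{I}$ is a tight rate function: for every $a>0$ the set $\mathbb{I}^{-1}([0,a])\subset\mathbf{X}$ is compact.
   Context: $C_b(\mathbf{X})$ denotes the space of all bounded continuous functions $F:\mathbf{X}\to\mathbb{R}$; real constants are identified with constant functions, and $F\le G$ and $F\vee G$ (maximum) are understood pointwise. A function $\mathbb{L}:C_b(\mathbf{X})\to\mathbb{R}$ (not assumed linear) is a Varadhan functional if: (i) $F\le G$ implies $\mathbb{L}(F)\le\mathbb{L}(G)$ for all $F,G\in C_b(\mathbf{X})$; and (ii) $\mathbb{L}(F+c)=\mathbb{L}(F)+c$ for all $F\in C_b(\mathbf{X})$ and all constants $c\in\mathbb{R}$. A Varadhan functional $\mathbb{L}$ is maximal if $\mathbb{L}(F\vee G)=\mathbb{L}(F)\vee\mathbb{L}(G)$ for all $F,G\in C_b(\mathbf{X})$, where $a\vee b$ is the maximum of two real numbers. A Varadhan functional $\mathbb{L}$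 is $\sigma$-continuous if $\mathbb{L}(F_n)\to\mathbb{L}(0)$ for every sequence $(F_n)$ in $C_b(\mathbf{X})$ with $F_n\searrow 0$, i.e. such that $F_n(x)$ is non-increasing in $n$ and converges to $0$ for each $x\in\mathbf{X}$. Convention: $F(x)-\mathbb{I}(x)=-\infty$ when $\mathbb{I}(x)=\infty$. *)

theory Defs
  imports "HOL-Analysis.Analysis"
begin

text \<open>The space of bounded continuous real functions on \<open>X\<close> is the library type \<open>'a \<Rightarrow>\<^sub>C real\<close>.
  A functional is any function on this type, without linearity.\<close>

definition bcontfun_max ::
  "('a::topological_space \<Rightarrow>\<^sub>C real) \<Rightarrow> ('a \<Rightarrow>\<^sub>C real) \<Rightarrow> ('a \<Rightarrow>\<^sub>C real)" where
  "bcontfun_max F G = Bcontfun (\<lambda>x. max (F x) (G x))"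

lemma apply_bcontfun_max [simp]: "apply_bcontfun (bcontfun_max F G) x = max (F x) (G x)"
proof -
  have "norm (max (F y) (G y)) \<le> max (norm F) (norm G)" for y
    using norm_bounded[of F y] norm_bounded[of G y] by (auto simp: max_def)
  then have "(\<lambda>y. max (F y) (G y)) \<in> bcontfun"
    by (intro bcontfun_normI continuous_on_max) auto
  then show ?thesis
    by (simp add: bcontfun_max_def Bcontfun_inverse)
qed

definition varadhan_functional :: "(('a::topological_space \<Rightarrow>\<^sub>C real) \<Rightarrow> real) \<Rightarrow> bool" where
  "varadhan_functional L \<longleftrightarrow>
     (\<forall>F G. (\<forall>x. apply_bcontfun F x \<le> apply_bcontfun G x) \<longrightarrow> L F \<le> L G) \<and>
     (\<forall>F c. L (F + const_bcontfun c) = L F + c)"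

definition maximal_functional :: "(('a::topological_space \<Rightarrow>\<^sub>C real) \<Rightarrow> real) \<Rightarrow> bool" where
  "maximal_functional L \<longleftrightarrow> (\<forall>F G. L (bcontfun_max F G) = max (L F) (L G))"

definition sigma_continuous :: "(('a::topological_space \<Rightarrow>\<^sub>C real) \<Rightarrow> real) \<Rightarrow> bool" where
  "sigma_continuous L \<longleftrightarrow>
     (\<forall>F :: nat \<Rightarrow> ('a \<Rightarrow>\<^sub>C real).
        (\<forall>x. decseq (\<lambda>n. apply_bcontfun (F n) x) \<and> (\<lambda>n. apply_bcontfun (F n) x) \<longlonglongrightarrow> 0)
        \<longrightarrow> (\<lambda>n. L (F n)) \<longlonglongrightarrow> L 0)"

definition rate_fun :: "(('a::topological_space \<Rightarrow>\<^sub>C real) \<Rightarrow> real) \<Rightarrow> 'a \<Rightarrow> ereal" where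
  "rate_fun L x = ereal (L 0) + (SUP F. ereal (apply_bcontfun F x - L F))"

text \<open>The first conjunct says that \<open>I\<close> takes values in \<open>[0,\<infinity>]\<close>, since \<open>ereal\<close> also
  has negative elements.\<close>

definition tight_rate_function :: "('a::topological_space \<Rightarrow> ereal) \<Rightarrow> bool" where
  "tight_rate_function I \<longleftrightarrow>
     (\<forall>x. 0 \<le> I x) \<and> (\<forall>a::real. a > 0 \<longrightarrow> compact (I -` {0..ereal a}))"

end

theory Submission
  imports Defs
begin

text \<open>
  The constant is \<open>L 0\<close>, and \<open>F x - rate_fun L x \<le> L F - L 0\<close> is immediate from the
  supremum defining the rate function. For the reverse inequality one needs, for each
  \<open>\<epsilon> > 0\<close>, a single point \<open>x\<close> at which \<open>G x - L G \<le> F x - L F + \<epsilon>\<close> for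
  every \<open>G\<close> at once. Normalising each \<open>G\<close> by a constant so that \<open>L G = L F - \<epsilon>\<close>, this says that
  the open sets \<open>{F < G}\<close> do not cover the space (\<open>maximal_dominating_point\<close>). If they did, the
  Lindelof property would leave countably many of them, and the partial maxima \<open>H n\<close>
  of the corresponding functions would satisfy \<open>L (H n) \<le> L F - \<epsilon>\<close> by maximality while
  eventually exceeding \<open>F\<close> at every point; the positive parts of \<open>F - H n\<close> then decrease to \<open>0\<close>.
  Since \<open>L\<close> is nonlinear and \<open>\<sigma>\<close>-continuity concerns only the limit \<open>0\<close>, convergence
  of \<open>L\<close> on these positive parts does not by itself control \<open>L F\<close>; the lemma
  \<open>maximal_le_of_increasing_cover\<close> overcomes this with one more use of maximality.

  For tightness, a sequence of functions decreasing pointwise to \<open>0\<close> becomes uniformly small on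
  each sublevel set of the rate function (\<open>eventually_small_on_rate_fun_sublevel\<close>). Applied to
  the truncated distances to the first \<open>n\<close> points of a dense sequence, this
  gives total boundedness. Sublevel sets are closed because the rate function is a
  supremum of continuous functions, so completeness of the space makes them compact.
\<close>

section \<open>Elementary properties\<close>

lemma varadhan_mono:
  assumes "varadhan_functional L" "\<And>x. apply_bcontfun F x \<le> apply_bcontfun G x"
  shows "L F \<le> L G"
  using assms unfolding varadhan_functional_def by blast

lemma varadhan_add_const:
  assumes "varadhan_functional L"
  shows "L (F + const_bcontfun c) = L F + c"
  using assms unfolding varadhan_functional_def by blast

lemma sigma_continuousD:
  assumes "sigma_continuous L"
    and "\<And>x. decseq (\<lambda>n. apply_bcontfun (D n) x)" "\<And>x. (\<lambda>n. apply_bcontfun (D n) x) \<longlonglongrightarrow> 0"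
  shows "(\<lambda>n. L (D n)) \<longlonglongrightarrow> L 0"
  using assms unfolding sigma_continuous_def by blast

lemma rate_fun_lower_bound: "ereal (L 0 + (apply_bcontfun F x - L F)) \<le> rate_fun L x"
proof -
  have "ereal (apply_bcontfun F x - L F) \<le> (SUP F. ereal (apply_bcontfun F x - L F))"
    by (rule SUP_upper) simp
  then have "ereal (L 0) + ereal (apply_bcontfun F x - L F) \<le> rate_fun L x"
    unfolding rate_fun_def by (rule add_left_mono)
  then show ?thesis by simp
qed

lemma rate_fun_upper_bound:
  assumes "\<And>G. apply_bcontfun G x - L G \<le> c"
  shows "rate_fun L x \<le> ereal (L 0 + c)"
proof -
  have "(SUP G. ereal (apply_bcontfun G x - L G)) \<le> ereal c"
    using assms by (intro SUP_least) simp
  then have "rate_fun L x \<le> ereal (L 0) + ereal c"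
    unfolding rate_fun_def by (rule add_left_mono)
  then show ?thesis by simp
qed

lemma rate_fun_nonneg: "0 \<le> rate_fun L x"
  using rate_fun_lower_bound[of L 0 x] by (simp add: zero_ereal_def)

section \<open>The variational representation\<close>

text \<open>
  Monotonicity with respect to an increasing sequence that overtakes \<open>F\<close> at each point, at a stage
  depending on the point. Where \<open>F\<close> exceeds \<open>H n\<close> by more than \<open>\<delta>\<close>, it is dominated by
  \<open>c * max (F - H n) 0 - K\<close> once \<open>c * \<delta> \<ge> K + norm F\<close>; elsewhere it is at most
  \<open>H n + \<delta>\<close>. By maximality \<open>L F\<close> is at most the larger of the values of \<open>L\<close>
  on these two bounds. The value on the first bound tends to \<open>L 0 - K\<close> as \<open>n\<close> grows, which is at most \<open>v\<close>
  for large \<open>K\<close>, whatever the size of the factor \<open>c\<close>.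
\<close>

lemma maximal_le_of_increasing_cover:
  assumes L: "varadhan_functional L" "maximal_functional L" "sigma_continuous L"
    and inc: "\<And>x. incseq (\<lambda>n. apply_bcontfun (H n) x)"
    and cover: "\<And>x. \<exists>n. apply_bcontfun F x \<le> apply_bcontfun (H n) x"
    and bound: "\<And>n. L (H n) \<le> v"
  shows "L F \<le> v"
proof (rule field_le_epsilon)
  fix \<delta> :: real assume \<delta>: "\<delta> > 0"
  define K where "K = \<bar>L 0 - v\<bar>"
  define c where "c = (K + norm F) / \<delta>"
  define D where "D n = c *\<^sub>R bcontfun_max (F - H n) 0" for n
  define E where "E n = D n + const_bcontfun (- K)" for n
  have c: "c \<ge> 0" using \<delta> by (simp add: c_def K_def)
  have D_apply: "D n x = c * max (F x - H n x) 0" for n x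
    by (simp add: D_def)
  have "(\<lambda>n. L (D n)) \<longlonglongrightarrow> L 0"
  proof (rule sigma_continuousD[OF L(3)])
    fix x
    show "decseq (\<lambda>n. D n x)"
      unfolding D_apply
      by (intro decseq_SucI mult_left_mono c max.mono diff_left_mono incseq_SucD[OF inc] order_refl)
    from cover obtain m where m: "F x \<le> H m x" by blast
    have "D n x = 0" if "n \<ge> m" for n
      using m incseqD[OF inc that, of x] by (simp add: D_apply max_def)
    then show "(\<lambda>n. D n x) \<longlonglongrightarrow> 0"
      by (intro tendsto_eventually) (auto simp: eventually_sequentially)
  qed
  then have "eventually (\<lambda>n. L (D n) < L 0 + \<delta>) sequentially"
    using \<delta> by (intro order_tendstoD) auto
  then obtain n where n: "L (D n) < L 0 + \<delta>"
    unfolding eventually_sequentially by blast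
  have "F x \<le> bcontfun_max (H n + const_bcontfun \<delta>) (E n) x" for x
  proof (cases "F x - H n x \<le> \<delta>")
    case True
    then show ?thesis by simp
  next
    case False
    then have "c * \<delta> \<le> D n x"
      unfolding D_apply using c by (intro mult_left_mono) auto
    moreover have "c * \<delta> = K + norm F" using \<delta> by (simp add: c_def)
    moreover have "F x \<le> norm F" using norm_bounded[of F x] by simp
    ultimately show ?thesis by (simp add: E_def)
  qed
  then have "L F \<le> L (bcontfun_max (H n + const_bcontfun \<delta>) (E n))"
    by (rule varadhan_mono[OF L(1)])
  also have "\<dots> = max (L (H n) + \<delta>) (L (D n) - K)"
    using L(2) by (simp add: maximal_functional_def varadhan_add_const[OF L(1)] E_def)
  also have "\<dots> \<le> v + \<delta>"
    using bound[of n] n by (simp add: K_def)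
  finally show "L F \<le> v + \<delta>" .
qed

primrec running_max ::
  "(nat \<Rightarrow> ('a::topological_space \<Rightarrow>\<^sub>C real)) \<Rightarrow> nat \<Rightarrow> ('a \<Rightarrow>\<^sub>C real)" where
  "running_max G 0 = G 0"
| "running_max G (Suc n) = bcontfun_max (running_max G n) (G (Suc n))"

lemma incseq_running_max: "incseq (\<lambda>n. apply_bcontfun (running_max G n) x)"
  by (rule incseq_SucI) simp

lemma le_running_max: "apply_bcontfun (G n) x \<le> apply_bcontfun (running_max G n) x"
  by (cases n) simp_all

lemma maximal_running_max_le:
  assumes "maximal_functional L" "\<And>n. L (G n) \<le> v"
  shows "L (running_max G n) \<le> v"
  using assms by (induction n) (auto simp: maximal_functional_def)

text \<open>
  Otherwise the open sets \<open>{F < G}\<close> with \<open>L G \<le> v\<close> cover the space, countably many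
  of them suffice, and the running maxima of the countably many \<open>G\<close> force \<open>L F \<le> v\<close>.
  Second countability enters here, to reduce an arbitrary family of competitors to a sequence.
\<close>

lemma maximal_dominating_point:
  fixes L :: "('a::second_countable_topology \<Rightarrow>\<^sub>C real) \<Rightarrow> real"
  assumes L: "varadhan_functional L" "maximal_functional L" "sigma_continuous L"
    and "v < L F"
  shows "\<exists>x. \<forall>G. L G \<le> v \<longrightarrow> apply_bcontfun G x \<le> apply_bcontfun F x"
proof (rule ccontr)
  assume "\<not> ?thesis"
  then have cover: "\<exists>G. L G \<le> v \<and> F x < G x" for x
    by (auto simp: not_le)
  define U where "U G = {x. F x < G x}" for G :: "'a \<Rightarrow>\<^sub>C real"
  have "open S" if "S \<in> U ` {G. L G \<le> v}" for S
    using that by (auto simp: U_def intro!: open_Collect_less)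
  then obtain \<U> where \<U>: "\<U> \<subseteq> U ` {G. L G \<le> v}" "countable \<U>" "\<Union>\<U> = \<Union>(U ` {G. L G \<le> v})"
    by (rule Lindelof)
  then obtain \<G> where \<G>: "countable \<G>" "\<G> \<subseteq> {G. L G \<le> v}" "\<U> = U ` \<G>"
    using countable_subset_image[of \<U> U "{G. L G \<le> v}"] by auto
  have \<G>_cover: "\<exists>G\<in>\<G>. F x < G x" for x
  proof -
    have "x \<in> \<Union>(U ` \<G>)"
      using cover[of x] \<U>(3) unfolding \<G>(3) by (auto simp: U_def)
    then show ?thesis by (auto simp: U_def)
  qed
  then have "\<G> \<noteq> {}" by blast
  define G where "G = from_nat_into \<G>"
  have range_G: "range G = \<G>"
    unfolding G_def using \<open>\<G> \<noteq> {}\<close> \<G>(1) by (rule range_from_nat_into)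
  have "L F \<le> v"
  proof (rule maximal_le_of_increasing_cover[OF L, where H = "running_max G"])
    fix x
    from \<G>_cover obtain n where "F x < G n x"
      using range_G by blast
    then have "F x \<le> running_max G n x" using le_running_max[of G n x] by linarith
    then show "\<exists>n. F x \<le> running_max G n x" ..
  next
    have "L (G n) \<le> v" for n using range_G \<G>(2) by auto
    then show "L (running_max G n) \<le> v" for n
      by (rule maximal_running_max_le[OF L(2)])
  qed (rule incseq_running_max)
  with \<open>v < L F\<close> show False by simp
qed

lemma maximal_variational_representation:
  fixes L :: "('a::second_countable_topology \<Rightarrow>\<^sub>C real) \<Rightarrow> real"
  assumes L: "varadhan_functional L" "maximal_functional L" "sigma_continuous L"
  shows "ereal (L F) = ereal (L 0) + (SUP x. ereal (apply_bcontfun F x) - rate_fun L x)"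
proof -
  have "(SUP x. ereal (F x) - rate_fun L x) = ereal (L F - L 0)"
  proof (rule antisym)
    show "(SUP x. ereal (F x) - rate_fun L x) \<le> ereal (L F - L 0)"
    proof (rule SUP_least)
      fix x
      have "ereal (F x) - rate_fun L x \<le> ereal (F x) - ereal (L 0 + (F x - L F))"
        using rate_fun_lower_bound by (intro ereal_minus_mono) auto
      then show "ereal (F x) - rate_fun L x \<le> ereal (L F - L 0)" by simp
    qed
    show "ereal (L F - L 0) \<le> (SUP x. ereal (F x) - rate_fun L x)"
    proof (rule ereal_le_epsilon2)
      fix \<epsilon> :: real assume "0 < \<epsilon>"
      then obtain x where x: "\<And>G. L G \<le> L F - \<epsilon> \<Longrightarrow> G x \<le> F x"
        using maximal_dominating_point[OF L, of "L F - \<epsilon>" F] by auto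
      \<comment> \<open>Shift \<open>G\<close> by the constant that puts it on the level \<open>L F - \<epsilon>\<close>.\<close>
      have "apply_bcontfun G x - L G \<le> F x - L F + \<epsilon>" for G
        using x[of "G + const_bcontfun (L F - \<epsilon> - L G)"] by (simp add: varadhan_add_const[OF L(1)])
      then have "rate_fun L x \<le> ereal (L 0 + (F x - L F + \<epsilon>))"
        by (rule rate_fun_upper_bound)
      then have "ereal (F x) - ereal (L 0 + (F x - L F + \<epsilon>)) \<le> ereal (F x) - rate_fun L x"
        by (intro ereal_minus_mono) auto
      also have "\<dots> \<le> (SUP x. ereal (F x) - rate_fun L x)"
        by (rule SUP_upper) simp
      finally have "ereal (L F - L 0 - \<epsilon>) \<le> (SUP x. ereal (F x) - rate_fun L x)"
        by (simp add: algebra_simps)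
      then have "ereal (L F - L 0 - \<epsilon>) + ereal \<epsilon> \<le> (SUP x. ereal (F x) - rate_fun L x) + ereal \<epsilon>"
        by (rule add_right_mono)
      then show "ereal (L F - L 0) \<le> (SUP x. ereal (F x) - rate_fun L x) + ereal \<epsilon>"
        by simp
    qed
  qed
  then show ?thesis by simp
qed

section \<open>Compactness of the sublevel sets\<close>

lemma closed_rate_fun_sublevel: "closed {x. rate_fun L x \<le> ereal a}"
proof -
  have "{x. rate_fun L x \<le> ereal a} = (\<Inter>F. {x. apply_bcontfun F x \<le> a - L 0 + L F})"
  proof (intro set_eqI iffI)
    fix x assume "x \<in> {x. rate_fun L x \<le> ereal a}"
    then have "ereal (L 0 + (apply_bcontfun F x - L F)) \<le> ereal a" for F
      using order_trans[OF rate_fun_lower_bound[of L F x]] by blast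
    then show "x \<in> (\<Inter>F. {x. apply_bcontfun F x \<le> a - L 0 + L F})"
      by (auto simp: algebra_simps)
  next
    fix x assume "x \<in> (\<Inter>F. {x. apply_bcontfun F x \<le> a - L 0 + L F})"
    then have "apply_bcontfun F x - L F \<le> a - L 0" for F
      by (auto simp: algebra_simps)
    from rate_fun_upper_bound[of x L, OF this]
    show "x \<in> {x. rate_fun L x \<le> ereal a}" by simp
  qed
  also have "closed \<dots>"
    by (intro closed_INT ballI closed_Collect_le) auto
  finally show ?thesis .
qed

text \<open>
  A Dini-type property. If \<open>rate_fun L x \<le> a\<close>, then \<open>c * D n x \<le> a - L 0 + L (c *\<^sub>R D n)\<close>
  for every \<open>n\<close> and \<open>c\<close>, a bound which is the same for all such \<open>x\<close> and tends to \<open>a\<close>.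
  Any positive \<open>c\<close> larger than \<open>a / \<epsilon>\<close> then brings \<open>D n x\<close> below \<open>\<epsilon>\<close>.
\<close>

lemma eventually_small_on_rate_fun_sublevel:
  fixes \<epsilon> :: real
  assumes "sigma_continuous L"
    and "\<And>x. decseq (\<lambda>n. apply_bcontfun (D n) x)" "\<And>x. (\<lambda>n. apply_bcontfun (D n) x) \<longlonglongrightarrow> 0"
    and "0 < \<epsilon>"
  shows "\<exists>n. \<forall>x. rate_fun L x \<le> ereal a \<longrightarrow> apply_bcontfun (D n) x < \<epsilon>"
proof -
  define c where "c = (\<bar>a\<bar> + 1) / \<epsilon>"
  have "c > 0" using \<open>0 < \<epsilon>\<close> by (simp add: c_def)
  have "(\<lambda>n. L (c *\<^sub>R D n)) \<longlonglongrightarrow> L 0"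
  proof (rule sigma_continuousD[OF assms(1)])
    fix x
    show "decseq (\<lambda>n. (c *\<^sub>R D n) x)"
      using assms(2)[of x] \<open>c > 0\<close> by (simp add: decseq_def)
    show "(\<lambda>n. (c *\<^sub>R D n) x) \<longlonglongrightarrow> 0"
      using tendsto_mult_right_zero[OF assms(3)[of x], of c] by simp
  qed
  then have "eventually (\<lambda>n. L (c *\<^sub>R D n) < L 0 + 1) sequentially"
    by (intro order_tendstoD) auto
  then obtain n where n: "L (c *\<^sub>R D n) < L 0 + 1"
    unfolding eventually_sequentially by blast
  have "D n x < \<epsilon>" if "rate_fun L x \<le> ereal a" for x
  proof -
    have "ereal (L 0 + (c * D n x - L (c *\<^sub>R D n))) \<le> ereal a"
      using order_trans[OF rate_fun_lower_bound[of L "c *\<^sub>R D n" x] that] by simp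
    then have "c * D n x < c * \<epsilon>"
      using n \<open>0 < \<epsilon>\<close> by (simp add: c_def)
    then show ?thesis using \<open>c > 0\<close> by simp
  qed
  then show ?thesis by blast
qed

text \<open>
  The functions \<open>min 1 (infdist x (A n))\<close>, with \<open>A n\<close> the first points of a dense sequence,
  decrease to \<open>0\<close>. Being uniformly small on the sublevel set means that finitely many
  small balls cover it. The truncation at \<open>1\<close> keeps the functions bounded.
\<close>

lemma compact_rate_fun_sublevel:
  fixes L :: "('a::polish_space \<Rightarrow>\<^sub>C real) \<Rightarrow> real"
  assumes "sigma_continuous L"
  shows "compact {x. rate_fun L x \<le> ereal a}"
  unfolding compact_eq_totally_bounded
proof (intro conjI allI impI)
  show "complete {x. rate_fun L x \<le> ereal a}"
    using closed_rate_fun_sublevel by (simp add: complete_eq_closed)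
next
  fix e :: real assume "0 < e"
  obtain S :: "'a set" where S: "countable S" "\<And>U. open U \<Longrightarrow> U \<noteq> {} \<Longrightarrow> \<exists>d\<in>S. d \<in> U"
    by (rule countable_dense_setE) blast
  have "S \<noteq> {}" using S(2)[of UNIV] by auto
  define s where "s = from_nat_into S"
  have range_s: "range s = S"
    unfolding s_def using \<open>S \<noteq> {}\<close> S(1) by (rule range_from_nat_into)
  define A where "A n = s ` {..n}" for n
  have A_ne: "A n \<noteq> {}" for n by (auto simp: A_def)
  define D where "D n = Bcontfun (\<lambda>x. min 1 (infdist x (A n)))" for n
  have "(\<lambda>x. min 1 (infdist x (A n))) \<in> bcontfun" for n
    by (rule bcontfun_normI[where b = 1])
       (auto intro!: continuous_intros simp: infdist_nonneg)
  then have D_apply: "D n x = min 1 (infdist x (A n))" for n x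
    by (simp add: D_def Bcontfun_inverse)
  have "decseq (\<lambda>n. D n x)" for x
  proof (rule decseq_SucI)
    fix n
    have "infdist x (A (Suc n)) \<le> infdist x (A n)"
      by (rule infdist_mono) (auto simp: A_ne, auto simp: A_def)
    then show "D (Suc n) x \<le> D n x" by (simp add: D_apply)
  qed
  moreover have "(\<lambda>n. D n x) \<longlonglongrightarrow> 0" for x
  proof (rule LIMSEQ_I)
    fix r :: real assume "0 < r"
    then obtain m where m: "dist x (s m) < r"
      using S(2)[of "ball x r"] range_s by force
    have "norm (D n x - 0) < r" if "n \<ge> m" for n
    proof -
      have "infdist x (A n) \<le> dist x (s m)"
        using that by (intro infdist_le) (auto simp: A_def)
      with m show ?thesis using infdist_nonneg[of x "A n"] by (simp add: D_apply)
    qed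
    then show "\<exists>m. \<forall>n\<ge>m. norm (D n x - 0) < r" by blast
  qed
  ultimately obtain n where n: "\<And>x. rate_fun L x \<le> ereal a \<Longrightarrow> D n x < min 1 e"
    using eventually_small_on_rate_fun_sublevel[OF assms, of D "min 1 e" a] \<open>0 < e\<close> by auto
  have "{x. rate_fun L x \<le> ereal a} \<subseteq> (\<Union>y\<in>A n. ball y e)"
  proof
    fix x assume "x \<in> {x. rate_fun L x \<le> ereal a}"
    then have "infdist x (A n) < e" using n[of x] by (auto simp: D_apply min_def split: if_splits)
    then obtain y where "y \<in> A n" "dist x y < e"
      using A_ne[of n] unfolding infdist_def
      by (auto simp: cInf_less_iff)
    then show "x \<in> (\<Union>y\<in>A n. ball y e)" by (auto simp: dist_commute)
  qed
  then show "\<exists>k. finite k \<and> {x. rate_fun L x \<le> ereal a} \<subseteq> (\<Union>y\<in>k. ball y e)"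
    by (intro exI[of _ "A n"]) (simp add: A_def)
qed

theorem theorem2p1:
  fixes L :: "('a::polish_space \<Rightarrow>\<^sub>C real) \<Rightarrow> real"
  assumes "varadhan_functional L"
    and "maximal_functional L"
    and "sigma_continuous L"
  shows "(\<exists>L0::real. \<forall>F. ereal (L F) = ereal L0 + (SUP x. ereal (apply_bcontfun F x) - rate_fun L x))
    \<and> tight_rate_function (rate_fun L)"
proof
  show "\<exists>L0::real. \<forall>F. ereal (L F) = ereal L0 + (SUP x. ereal (apply_bcontfun F x) - rate_fun L x)"
    using maximal_variational_representation[OF assms] by blast
  have "rate_fun L -` {0..ereal a} = {x. rate_fun L x \<le> ereal a}" for a
    by (auto simp: rate_fun_nonneg)
  then show "tight_rate_function (rate_fun L)"
    unfolding tight_rate_function_def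
    using rate_fun_nonneg[of L] compact_rate_fun_sublevel[OF assms(3)] by simp
qed

end
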